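(* Let $N\ge1$ and let $U=(u_{ij})\in\mathrm{PC}_N(U(1))$. Then $U$ is realizable by a non-orthogonal family of pure qubit states if and only if there exists a Hermitian positive semidefinite matrix $G=(g_{ij})\in M_N(\mathbb{C})$ such that: (i) $g_{ii}=1$ for all $i$; (ii) $\mathrm{rank}(G)\le 2$; (iii) $g_{ij}\ne0$ for all $i,j$; (iv) $\dfrac{g_{ij}}{|g_{ij}|}=u_{ij}$ for all $i,j$.
   Context: $\langle\cdot|\cdot\rangle$ is the standard Hermitian inner product on $\mathbb{C}^2$, conjugate-linear in the first argument. $U(1)=\{z\in\mathbb{C}:|z|=1\}$. $\mathrm{PC}_N(U(1))$ is the set of matrices $(u_{ij})_{1\le i,j\le N}$ with entries in $U(1)$ such that $u_{ii}=1$ and $u_{ji}=u_{ij}^{-1}$ for all $i,j$. Such a matrix $U$ is realizable by a non-orthogonal family of pure qubit states if there exist vectors $\psi_1,\dots,\psi_N\in\mathbb{C}^2$ of norm $1$ with $\langle\psi_i|\psi_j\rangle\ne0$ for all $i,j$ and $u_{ij}=\langle\psi_i|\psi_j\rangle/|\langle\psi_i|\psi_j\rangle|$ for all $i,j$. *)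

theory Defs
  imports "HOL-Analysis.Analysis"
begin

(* Matrices in M_N(C) are elements of complex^'n^'n, where the finite type 'n plays the
   role of the index set {1..N}, N = CARD('n); types are nonempty, so N >= 1. *)

definition cinner :: "complex^'n \<Rightarrow> complex^'n \<Rightarrow> complex" where
  "cinner x y = (\<Sum>i\<in>UNIV. cnj (x $ i) * y $ i)"

definition U1 :: "complex set" where
  "U1 = {z. cmod z = 1}"

definition PC :: "(complex^'n^'n) set" where
  "PC = {U. (\<forall>i j. U $ i $ j \<in> U1) \<and> (\<forall>i. U $ i $ i = 1)
            \<and> (\<forall>i j. U $ j $ i = inverse (U $ i $ j))}"

definition qubit_realizable :: "complex^'n^'n \<Rightarrow> bool" where
  "qubit_realizable U \<longleftrightarrow>
     (\<exists>\<psi> :: 'n \<Rightarrow> complex^2.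
        (\<forall>i. norm (\<psi> i) = 1) \<and>
        (\<forall>i j. cinner (\<psi> i) (\<psi> j) \<noteq> 0) \<and>
        (\<forall>i j. U $ i $ j
                = cinner (\<psi> i) (\<psi> j) / complex_of_real (cmod (cinner (\<psi> i) (\<psi> j)))))"

definition conj_transpose :: "complex^'n^'m \<Rightarrow> complex^'m^'n" where
  "conj_transpose A = (\<chi> i j. cnj (A $ j $ i))"

definition hermitian :: "complex^'n^'n \<Rightarrow> bool" where
  "hermitian A \<longleftrightarrow> conj_transpose A = A"

(* For Hermitian A the form cinner x (A *v x) is real-valued, so Re discards nothing. *)
definition hermitian_psd :: "complex^'n^'n \<Rightarrow> bool" where
  "hermitian_psd A \<longleftrightarrow> hermitian A \<and> (\<forall>x. 0 \<le> Re (cinner x (A *v x)))"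

end

theory Submission
  imports Defs
begin

text \<open>
  The Gram matrix of a realizing family satisfies (i)--(iv). Conversely, \<open>G\<close> is a Gram matrix of
  qubit vectors by an explicit Cholesky factorization. Fix an index \<open>p\<close> and let
  \<open>h i j = g i j - g i p * g p j\<close> be the Schur complement of the unit pivot \<open>g p p\<close>. If
  some \<open>g p q\<close> has modulus below 1, rows \<open>p\<close> and \<open>q\<close> are independent, so by the rank bound
  they span all rows, which forces \<open>h i j = h i q * h q j / h q q\<close>, and the vectors
  \<open>(g p j, h q j / sqrt (h q q))\<close> have Gram matrix \<open>G\<close>. Otherwise positivity forces \<open>h = 0\<close>.
\<close>

definition gram :: "('n \<Rightarrow> complex^'m) \<Rightarrow> complex^'n^'n" where
  "gram \<psi> = (\<chi> i j. cinner (\<psi> i) (\<psi> j))"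

lemma gram_nth [simp]: "gram \<psi> $ i $ j = cinner (\<psi> i) (\<psi> j)"
  by (simp add: gram_def)

lemma cinner_commute: "cinner x y = cnj (cinner y x)"
  by (simp add: cinner_def mult.commute)

lemma cinner_add_left: "cinner (x + y) z = cinner x z + cinner y z"
  by (simp add: cinner_def algebra_simps sum.distrib)

lemma cinner_add_right: "cinner x (y + z) = cinner x y + cinner x z"
  by (simp add: cinner_def algebra_simps sum.distrib)

lemma cinner_scale_left: "cinner (c *s x) y = cnj c * cinner x y"
  by (simp add: cinner_def sum_distrib_left mult.assoc)

lemma cinner_scale_right: "cinner x (c *s y) = c * cinner x y"
  by (simp add: cinner_def sum_distrib_left mult_ac)

lemma cinner_self: "cinner x x = of_real ((norm x)\<^sup>2)"
proof -
  have "(norm x)\<^sup>2 = (\<Sum>i\<in>UNIV. (cmod (x $ i))\<^sup>2)"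
    by (simp add: norm_vec_def L2_set_def sum_nonneg)
  then show ?thesis
    unfolding cinner_def by (simp only: of_real_sum complex_norm_square mult.commute)
qed

lemma cinner_axis: "cinner (axis i a) y = cnj a * y $ i"
  by (simp add: cinner_def axis_def if_distrib[of cnj] if_distrib[of "\<lambda>z. z * _"] cong: if_cong)

lemma matrix_vector_mult_axis:
  fixes A :: "'a::comm_semiring_1^'n^'m"
  shows "(A *v axis j a) $ i = A $ i $ j * a"
  by (simp add: matrix_vector_mult_def axis_def if_distrib[of "\<lambda>z. _ * z"] cong: if_cong)

lemma hermitian_nth: "hermitian A \<Longrightarrow> cnj (A $ i $ j) = A $ j $ i"
  unfolding hermitian_def conj_transpose_def by (metis vec_lambda_beta)

lemma hermitian_cinner:
  assumes "hermitian A"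
  shows "cinner x (A *v y) = cinner (A *v x) y"
proof -
  have "cinner x (A *v y) = (\<Sum>i\<in>UNIV. \<Sum>j\<in>UNIV. cnj (x $ i) * A $ i $ j * y $ j)"
    by (simp add: cinner_def matrix_vector_mult_def sum_distrib_left mult.assoc)
  also have "\<dots> = (\<Sum>j\<in>UNIV. \<Sum>i\<in>UNIV. cnj (x $ i) * A $ i $ j * y $ j)"
    by (rule sum.swap)
  also have "\<dots> = cinner (A *v x) y"
    by (simp add: cinner_def matrix_vector_mult_def sum_distrib_right hermitian_nth[OF assms]) (simp add: mult.commute)
  finally show ?thesis .
qed

text \<open>Perturb \<open>x\<close> by a real multiple \<open>t\<close> of
  \<open>y = A *v x\<close>. The form becomes \<open>2 * t * s + t\<^sup>2 * c\<close> with
  \<open>s\<close> the squared norm of \<open>y\<close>. If \<open>s > 0\<close>, the linear term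
  dominates near 0 and makes this negative for a small negative \<open>t\<close>.\<close>

lemma hermitian_psd_kernel:
  assumes "hermitian_psd A" and zero: "Re (cinner x (A *v x)) = 0"
  shows "A *v x = 0"
proof (rule ccontr)
  assume nz: "A *v x \<noteq> 0"
  define y where "y = A *v x"
  define c where "c = Re (cinner y (A *v y))"
  define s where "s = (norm y)\<^sup>2"
  have herm: "hermitian A" and psd: "0 \<le> Re (cinner z (A *v z))" for z
    using assms(1) by (auto simp: hermitian_psd_def)
  have s: "s > 0" and c: "c \<ge> 0"
    using nz psd by (auto simp: s_def y_def c_def)
  have xy: "cinner x (A *v y) = of_real s"
    by (simp add: hermitian_cinner[OF herm] cinner_self s_def flip: y_def)
  have yx: "cinner y (A *v x) = of_real s"
    by (simp add: cinner_self s_def flip: y_def)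
  have nonneg: "0 \<le> 2 * t * s + t\<^sup>2 * c" for t
  proof -
    let ?z = "x + complex_of_real t *s y"
    have "cinner ?z (A *v ?z) = cinner x (A *v x) + of_real (2 * t * s) + (of_real t)\<^sup>2 * cinner y (A *v y)"
      by (simp add: matrix_vector_right_distrib vec.scale cinner_add_left cinner_add_right
          cinner_scale_left cinner_scale_right xy yx algebra_simps power2_eq_square)
    then have "Re (cinner ?z (A *v ?z)) = 2 * t * s + t\<^sup>2 * c"
      using zero by (simp add: c_def flip: of_real_power)
    then show ?thesis using psd[of ?z] by simp
  qed
  \<comment> \<open>The minimizer would be \<open>- s / c\<close>; adding 1 to the denominator also
    covers \<open>c = 0\<close>, and the quadratic still takes the negative value
    \<open>- (t\<^sup>2 * (c + 2))\<close>.\<close>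
  define t where "t = - s / (c + 1)"
  have st: "s = - t * (c + 1)" "t \<noteq> 0"
    using s c by (simp_all add: t_def)
  have "0 \<le> - (t\<^sup>2 * (c + 2))"
    using nonneg[of t] unfolding st(1) by (simp add: algebra_simps power2_eq_square)
  moreover have "t\<^sup>2 * (c + 2) > 0"
    using \<open>t \<noteq> 0\<close> c by simp
  ultimately show False by linarith
qed

text \<open>The form at \<open>x\<close> is the squared norm of the combination of the
  \<open>\<psi> j\<close> with coefficients \<open>x $ j\<close>.\<close>

lemma hermitian_psd_gram: "hermitian_psd (gram \<psi>)"
proof -
  have "cinner x (gram \<psi> *v x) = cinner (\<Sum>j\<in>UNIV. x $ j *s \<psi> j) (\<Sum>j\<in>UNIV. x $ j *s \<psi> j)" for x
  proof -
    have "cinner x (gram \<psi> *v x) =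
        (\<Sum>i\<in>UNIV. \<Sum>j\<in>UNIV. \<Sum>k\<in>UNIV. cnj (x $ i * \<psi> i $ k) * (x $ j * \<psi> j $ k))"
      by (simp add: cinner_def matrix_vector_mult_def sum_distrib_left sum_distrib_right mult_ac)
    also have "\<dots> = (\<Sum>i\<in>UNIV. \<Sum>k\<in>UNIV. \<Sum>j\<in>UNIV. cnj (x $ i * \<psi> i $ k) * (x $ j * \<psi> j $ k))"
      by (rule sum.cong[OF refl], rule sum.swap)
    also have "\<dots> = (\<Sum>k\<in>UNIV. \<Sum>i\<in>UNIV. \<Sum>j\<in>UNIV. cnj (x $ i * \<psi> i $ k) * (x $ j * \<psi> j $ k))"
      by (rule sum.swap)
    also have "\<dots> = cinner (\<Sum>j\<in>UNIV. x $ j *s \<psi> j) (\<Sum>j\<in>UNIV. x $ j *s \<psi> j)"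
      by (simp add: cinner_def sum_product)
    finally show ?thesis .
  qed
  moreover have "hermitian (gram \<psi>)"
    by (simp add: hermitian_def conj_transpose_def vec_eq_iff flip: cinner_commute)
  ultimately show ?thesis
    by (simp add: hermitian_psd_def cinner_self)
qed

text \<open>Each row is a combination of the vectors \<open>v k\<close>, one per coordinate of the
  ambient space, where \<open>v k\<close> collects the \<open>k\<close>-th coordinates of the whole
  family.\<close>

lemma rank_gram_le:
  fixes \<psi> :: "'n::finite \<Rightarrow> complex^'m"
  shows "rank (gram \<psi>) \<le> CARD('m)"
proof -
  define v where "v k = (\<chi> j. \<psi> j $ k)" for k
  have "row i (gram \<psi>) = (\<Sum>k\<in>UNIV. cnj (\<psi> i $ k) *s v k)" for i
    by (simp add: vec_eq_iff row_def cinner_def v_def)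
  then have "rows (gram \<psi>) \<subseteq> vec.span (range v)"
    by (auto simp: rows_def intro!: vec.span_sum vec.span_scale intro: vec.span_base)
  then have "rank (gram \<psi>) \<le> card (range v)"
    unfolding row_rank_def_gen by (rule vec.dim_le_card) simp
  also have "\<dots> \<le> CARD('m)"
    by (rule card_image_le) simp
  finally show ?thesis .
qed

text \<open>Proportional rows would make the minor vanish, so rows \<open>p\<close> and
  \<open>q\<close> are independent; two independent vectors in a row space of dimension at most 2
  span it.\<close>

lemma rank_le_2_rows:
  fixes A :: "'a::field^'n^'m"
  assumes rank: "rank A \<le> 2" and minor: "A $ p $ r * A $ q $ s \<noteq> A $ p $ s * A $ q $ r"
  obtains a b where "\<And>k. A $ i $ k = a * A $ p $ k + b * A $ q $ k"
proof -
  have nz: "row p A \<noteq> 0"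
  proof
    assume "row p A = 0"
    then have "A $ p $ k = 0" for k
      by (simp add: row_def vec_eq_iff)
    then show False using minor by simp
  qed
  have nspan: "row q A \<notin> vec.span {row p A}"
    using minor by (auto simp: vec.span_singleton row_def vec_eq_iff)
  then have neq: "row q A \<noteq> row p A"
    by (auto intro: vec.span_base)
  have "vec.independent {row q A, row p A}"
    using nz nspan by (intro vec.independent_insertI) (auto simp: vec.independent_empty)
  then have "rows A \<subseteq> vec.span {row q A, row p A}"
    using rank neq by (intro vec.card_ge_dim_independent) (auto simp: rows_def row_rank_def_gen)
  then have "row i A \<in> vec.span {row q A, row p A}"
    by (auto simp: rows_def)
  then obtain b a where "row i A - b *s row q A = a *s row p A"
    by (auto simp: vec.span_breakdown_eq vec.span_singleton)
  then have "row i A = a *s row p A + b *s row q A"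
    by (simp add: algebra_simps)
  then show thesis
    by (intro that[of a b]) (simp add: row_def vec_eq_iff)
qed

lemma psd_rank_2_is_gram:
  fixes G :: "complex^'n^'n"
  assumes psd: "hermitian_psd G" and diag: "\<And>i. G $ i $ i = 1" and rank: "rank G \<le> 2"
  obtains \<psi> :: "'n \<Rightarrow> complex^2" where "G = gram \<psi>"
proof -
  have herm: "cnj (G $ i $ j) = G $ j $ i" for i j
    using psd by (simp add: hermitian_psd_def hermitian_nth)
  fix p :: 'n
  define h where "h i j = G $ i $ j - G $ i $ p * G $ p $ j" for i j
  have h_herm: "cnj (h i j) = h j i" for i j
    by (simp add: h_def herm mult.commute)
  have hp: "h p j = 0" for j
    by (simp add: h_def diag)
  \<comment> \<open>The elimination step for the pivot: the \<open>p\<close>-th coordinate is chosen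
    so that \<open>G *v x q\<close> is column \<open>q\<close> of \<open>h\<close>. As
    \<open>h p q = 0\<close>, the form at \<open>x q\<close> is just \<open>h q q\<close>, so
    positivity of \<open>G\<close> reaches the diagonal of \<open>h\<close>.\<close>
  define x where "x q = axis q 1 + axis p (- (G $ p $ q))" for q
  have Gx: "(G *v x q) $ i = h i q" for i q
    by (simp add: x_def matrix_vector_right_distrib matrix_vector_mult_axis h_def)
  have Qx: "cinner (x q) (G *v x q) = h q q" for q
    by (subst x_def) (simp add: cinner_add_left cinner_axis Gx hp)
  have h_real: "h q q = of_real (Re (h q q))" for q
    using h_herm[of q q] by (simp add: complex_eq_iff)
  have h_nonneg: "0 \<le> Re (h q q)" for q
    using psd by (simp add: hermitian_psd_def flip: Qx)
  show thesis
  proof (cases "\<exists>q. h q q \<noteq> 0")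
    case True
    then obtain q where q: "h q q \<noteq> 0" by blast
    define d where "d = Re (h q q)"
    have d: "h q q = of_real d"
      unfolding d_def by (rule h_real)
    have "d > 0"
      using h_nonneg[of q] q d unfolding d_def by (metis less_le of_real_0)
    define \<psi> where "\<psi> j = (vector [G $ p $ j, h q j / of_real (sqrt d)] :: complex^2)" for j
    have h_factor: "h i j * of_real d = h i q * h q j" for i j
    proof -
      \<comment> \<open>The principal minor on \<open>p\<close> and \<open>q\<close> equals
        \<open>h q q\<close>, because the diagonal of \<open>G\<close> is 1.\<close>
      have "G $ p $ p * G $ q $ q \<noteq> G $ p $ q * G $ q $ p"
        using q by (simp add: h_def diag mult.commute)
      then obtain a b where "\<And>k. G $ i $ k = a * G $ p $ k + b * G $ q $ k"
        by (rule rank_le_2_rows[OF rank]) blast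
      \<comment> \<open>Elimination kills the \<open>p\<close>-row part of the combination. The
        unknown \<open>b\<close> then drops out on comparing the columns \<open>q\<close> and
        \<open>j\<close>.\<close>
      then have "h i k = b * h q k" for k
        by (simp add: h_def diag algebra_simps)
      then show ?thesis by (simp add: d flip: mult.assoc)
    qed
    have "cinner (\<psi> i) (\<psi> j) = G $ i $ j" for i j
    proof -
      have "complex_of_real (sqrt d) * of_real (sqrt d) = of_real d"
        using \<open>d > 0\<close> by (simp flip: of_real_mult)
      \<comment> \<open>Conjugating the left argument turns \<open>G $ p $ i\<close> into
        \<open>G $ i $ p\<close> and \<open>h q i\<close> into \<open>h i q\<close>.\<close>
      then have "cinner (\<psi> i) (\<psi> j) = G $ i $ p * G $ p $ j + h i q * h q j / of_real d"
        by (simp add: cinner_def \<psi>_def sum_2 herm h_herm)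
      also have "h i q * h q j / of_real d = h i j"
        using h_factor[of i j] \<open>d > 0\<close> by (simp add: field_simps)
      finally show ?thesis by (simp add: h_def)
    qed
    then show thesis
      by (intro that[of \<psi>]) (simp add: vec_eq_iff)
  next
    case False
    \<comment> \<open>The form vanishes at every \<open>x q\<close>, so the kernel lemma annihilates
      whole columns of \<open>h\<close>, not only its diagonal.\<close>
    then have "G *v x q = 0" for q
      by (intro hermitian_psd_kernel[OF psd]) (simp add: Qx)
    then have "h i j = 0" for i j
      by (simp flip: Gx)
    then have "G $ i $ p * G $ p $ j = G $ i $ j" for i j
      by (metis eq_iff_diff_eq_0 h_def)
    \<comment> \<open>Here \<open>G\<close> has rank one; a zero second coordinate places the
      scalars \<open>G $ p $ j\<close> in the qubit space.\<close>
    then have "cinner (vector [G $ p $ i, 0] :: complex^2) (vector [G $ p $ j, 0]) = G $ i $ j" for i j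
      by (simp add: cinner_def sum_2 herm)
    then show thesis
      by (intro that[of "\<lambda>j. vector [G $ p $ j, 0]"]) (simp add: vec_eq_iff)
  qed
qed

theorem corollary5p2:
  fixes U :: "complex^'n^'n"
  assumes "U \<in> PC"
  shows "qubit_realizable U \<longleftrightarrow>
    (\<exists>G :: complex^'n^'n.
        hermitian_psd G \<and>
        (\<forall>i. G $ i $ i = 1) \<and>
        rank G \<le> 2 \<and>
        (\<forall>i j. G $ i $ j \<noteq> 0) \<and>
        (\<forall>i j. G $ i $ j / complex_of_real (cmod (G $ i $ j)) = U $ i $ j))"
proof
  assume "qubit_realizable U"
  then obtain \<psi> :: "'n \<Rightarrow> complex^2" where
    "\<forall>i. norm (\<psi> i) = 1" "\<forall>i j. cinner (\<psi> i) (\<psi> j) \<noteq> 0"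
    "\<forall>i j. U $ i $ j = cinner (\<psi> i) (\<psi> j) / complex_of_real (cmod (cinner (\<psi> i) (\<psi> j)))"
    unfolding qubit_realizable_def by blast
  moreover have "rank (gram \<psi>) \<le> 2"
    using rank_gram_le[of \<psi>] by simp
  ultimately show "\<exists>G. hermitian_psd G \<and> (\<forall>i. G $ i $ i = 1) \<and> rank G \<le> 2 \<and>
      (\<forall>i j. G $ i $ j \<noteq> 0) \<and>
      (\<forall>i j. G $ i $ j / complex_of_real (cmod (G $ i $ j)) = U $ i $ j)"
    by (intro exI[of _ "gram \<psi>"]) (simp add: hermitian_psd_gram cinner_self)
next
  assume "\<exists>G. hermitian_psd G \<and> (\<forall>i. G $ i $ i = 1) \<and> rank G \<le> 2 \<and>
      (\<forall>i j. G $ i $ j \<noteq> 0) \<and>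
      (\<forall>i j. G $ i $ j / complex_of_real (cmod (G $ i $ j)) = U $ i $ j)"
  then obtain G where G: "hermitian_psd G" "\<And>i. G $ i $ i = 1" "rank G \<le> 2"
      "\<And>i j. G $ i $ j \<noteq> 0"
      "\<And>i j. G $ i $ j / complex_of_real (cmod (G $ i $ j)) = U $ i $ j"
    by blast
  obtain \<psi> :: "'n \<Rightarrow> complex^2" where \<psi>: "G = gram \<psi>"
    using psd_rank_2_is_gram[OF G(1-3)] by blast
  \<comment> \<open>The unit diagonal of \<open>G\<close> is the normalization of the family; the
    nonvanishing and phase conditions carry over entrywise.\<close>
  have "norm (\<psi> i) = 1" for i
  proof -
    have "complex_of_real ((norm (\<psi> i))\<^sup>2) = of_real 1"
      using G(2)[of i] by (simp add: \<psi> cinner_self)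
    then have "(norm (\<psi> i))\<^sup>2 = 1"
      unfolding of_real_eq_iff .
    then show ?thesis
      by (simp add: power2_eq_1_iff) (smt (verit) norm_ge_zero)
  qed
  then show "qubit_realizable U"
    unfolding qubit_realizable_def using G(4,5) by (intro exI[of _ \<psi>]) (simp add: \<psi>)
qed

end
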